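(* Let the positive definiteness, average dwell-time, state convergence, bounded inputs and Lipschitz assumptions (all stated in the context) hold for the system $x_{t+1}=f(x_t,u_t)$, the class of cost functions $\mathcal V$ and the algorithm $\mathcal A$, and let $\varphi\ge\underline\varphi$, where $\varphi$ is the average dwell time and $\underline\varphi$ is the dwell-time threshold described in the context. The algorithm $\mathcal A$ achieves bounded dynamic regret if there exists a constant $M$ such that $$\lim_{T\to\infty}\sum_{t=0}^T\sigma(t)\le M,$$ where $\sigma$ is the function from the state convergence assumption.
   Context: Setting. $\alpha:\mathbb R_{\ge0}\to\mathbb R_{\ge0}$ is of class $\mathcal K$ if it is continuous, strictly increasing and $\alpha(0)=0$; $\sigma:\mathbb Z_{\ge0}\to\mathbb R_{\ge0}$ is of class $\mathcal L$ if it is nonincreasing with limit $0$. $\|\cdot\|$ is the Euclidean norm. The system is $x_{t+1}=f(x_t,u_t)$ with $f:\mathbb R^n\times\mathbb R^m\to\mathbb R^n$, $t\in\mathbb Z_{\ge0}$. The cost functions $L_t:\mathbb R^m\times\mathbb R^n\to\mathbb R$ are time-varying, a priori unknown and belong to a class $\mathcal V$. The algorithm is a mapping $u_t=\mathcal A(\mathcal I_t)$ of the available information $\mathcal I_t=\{x_0,\dots,x_t,u_0,\dots,u_{t-1},L_0,\dots,L_{t-1},i_0\}$, with $i_0$ prior information (e.g. the initialization of the algorithm). A constant cost function $L$ means $L_t=L$ for all $t$. Positive definiteness assumption. Every $L_t\in\mathcal V$ is positive definite with respect to a (time-varying) steady state $(\eta_t,\theta_t)\in\mathbb R^m\times\mathbb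 R^n$ of the system: $\theta_t=f(\theta_t,\eta_t)$, $L_t(\eta_t,\theta_t)=0$, $L_t(u,x)>0$ for all $(u,x)\ne(\eta_t,\theta_t)$; and there exists $\lambda\in\mathcal K$ with $\lambda(\|(u,x)-(\eta_t,\theta_t)\|)\le L_t(u,x)$ for all $L_t\in\mathcal V$ and all $(u,x)\in\mathbb R^m\times\mathbb R^n$. For a constant cost $L$ the steady state is written $(\eta,\theta)$. Switching times. $N$ is the number of time steps in $[0,T]$ at which the cost function $L_t$ switches (including $t=0$), and $t_i$, $i\in[0,N-1]$, are the time instances at which it changes: $t_0=0$, $L_t\ne L_{t-1}$ if and only if $t=t_i$ for some $i\in[1,N-1]$, and $L_t=L_{t_i}$ for $t\in[t_i,t_{i+1}-1]$. Additionally $t_N=T$. Set $(\Delta\sigma)_j=\sigma(t_j-t_{j-1})$. Average dwell-time assumption (the cost functions are not allowed to change too frequently). Denote by $\mathcal N(\tau_1,\tau_2)$ the number of times the cost function switches in the interval $[\tau_1,\tau_2]\subseteq\mathbb Z_{[0,T]}$. There exist constants $N_0\in\mathbb Z_{\ge0}$ and $\varphi>0$ (the average dwell time) such that $\mathcal N(\tau_1,\tau_2)<N_0+\frac1\varphi(\tau_2-\tau_1)$. State convergence assumption. $\mathcal A$ and $\mathcal V$ are such that there exist $\sigma\in\mathcal L$ with $\sigma(0)=1$ and a constant $k\ge1$ such that $\mathcal A$ in closed loop with the system satisfies $\|x_t-\theta\|\le k\|x_0-\theta\|\sigma(t)$ for all $t\in\mathbb Z_{\ge0}$ and any constant cost function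 $L\in\mathcal V$. Dwell-time threshold. Under the average dwell-time and state convergence assumptions, for every $N_0\in\mathbb Z_{\ge0}$ there exist $\underline\varphi>0$ and $P>0$ such that for every $\varphi\ge\underline\varphi$ and any $N'\in\mathbb Z_{>N_0}$ it holds that $\sum_{i=0}^{N'}\prod_{j=1}^i k(\Delta\sigma)_j\le P$ (a lemma of the source); $\underline\varphi$ in the claim is such a constant for the given $N_0$. Bounded inputs assumption. $\mathcal A$ and $\mathcal V$ are such that the inputs satisfy $\|u_t-\eta_{t-1}\|\le k_u\|u_{t-1}-\eta_{t-1}\|+k_x\|x_t-\theta_{t-1}\|+k_\zeta\|\zeta_{t-1}-\zeta_{t-2}\|$ for all $t\in\mathbb Z_{\ge0}$, where $\zeta_t=[\theta_t^\top\ \eta_t^\top]^\top$, $\zeta_t=\zeta_0$ for $t<0$, $u_{-1}=\eta_0$, $k_u\in[0,1)$ and $k_x,k_\zeta\ge0$. Lipschitz assumption. All cost functions in $\mathcal V$ are Lipschitz continuous: there exists $l>0$ such that $\|L_t(u_1,x_1)-L_t(u_2,x_2)\|\le l\|(u_1,x_1)-(u_2,x_2)\|$ for all $t\in\mathbb Z_{\ge0}$ and all $(u_1,x_1),(u_2,x_2)\in\mathbb R^m\times\mathbb R^n$. Bounded dynamic regret. With $\mathcal R_T(x_0,u)=\sum_{t=0}^T\big(L_t(u_t,x_t)-L_t(\eta_t,\theta_t)\big)$, $\mathcal A$ achieves bounded dynamic regret if, for any initial state $x_0\in\mathbb R^n$, there exist constants $C_\eta,C_\theta,C\ge0$, independent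 of $T$, such that $\mathcal R_T(x_0,u)\le C_\eta\sum_{t=1}^T\|\eta_t-\eta_{t-1}\|+C_\theta\sum_{t=1}^T\|\theta_t-\theta_{t-1}\|+C$ holds for any sequence of cost functions $L_0,\dots,L_T\in\mathcal V$ (in the present claim, the sequences are subject to the average dwell-time assumption).
   Formalization: Added: after each switch at s, if the cost then stays constant, the state convergence bound (same k, σ) holds restarted from x_{s+1}; else one switch can destabilize. C may also depend on a bound r on ‖x_0−θ_0‖, since no uniform C exists in general if the steady states θ are unbounded. *)

theory Defs
  imports "HOL-Analysis.Analysis"
begin

definition class_K :: "(real \<Rightarrow> real) \<Rightarrow> bool" where
  "class_K \<alpha> \<longleftrightarrow> continuous_on {0..} \<alpha> \<and> strict_mono_on {0..} \<alpha> \<and> \<alpha> 0 = 0"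

definition class_L :: "(nat \<Rightarrow> real) \<Rightarrow> bool" where
  "class_L \<sigma> \<longleftrightarrow> (\<forall>t. 0 \<le> \<sigma> t) \<and> antimono \<sigma> \<and> \<sigma> \<longlonglongrightarrow> 0"

text \<open>A cost is a function of the pair (input, state); the norm of the product type is the
  Euclidean norm of the stacked vector.\<close>

type_synonym ('m, 'n) cost = "(real ^ 'm) \<times> (real ^ 'n) \<Rightarrow> real"

text \<open>An algorithm receives the states \<open>x\<^sub>0, \<dots>, x\<^sub>t\<close>, the past inputs \<open>u\<^sub>0, \<dots>, u\<^bsub>t-1\<^esub>\<close>, the past
  costs \<open>L\<^sub>0, \<dots>, L\<^bsub>t-1\<^esub>\<close> and the prior information, which may be of any type.\<close>

type_synonym ('m, 'n, 'i) algorithm =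
  "(real ^ 'n) list \<Rightarrow> (real ^ 'm) list \<Rightarrow> ('m, 'n) cost list \<Rightarrow> 'i \<Rightarrow> real ^ 'm"

definition closed_loop ::
  "(real ^ 'n \<Rightarrow> real ^ 'm \<Rightarrow> real ^ 'n) \<Rightarrow> ('m, 'n, 'i) algorithm \<Rightarrow> 'i \<Rightarrow>
    (nat \<Rightarrow> ('m, 'n) cost) \<Rightarrow> (nat \<Rightarrow> real ^ 'n) \<Rightarrow> (nat \<Rightarrow> real ^ 'm) \<Rightarrow> bool" where
  "closed_loop f A i0 L x u \<longleftrightarrow>
    (\<forall>t. u t = A (map x [0..<Suc t]) (map u [0..<t]) (map L [0..<t]) i0 \<and>
         x (Suc t) = f (x t) (u t))"

text \<open>The steady state of a positive definite cost is its unique zero, so it is given by maps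
  \<open>\<eta>\<close>, \<open>\<theta>\<close> on costs; along a sequence \<open>L\<close>, the steady state at time \<open>t\<close> is \<open>(\<eta> (L t), \<theta> (L t))\<close>.\<close>

definition positive_definite_costs ::
  "(real ^ 'n \<Rightarrow> real ^ 'm \<Rightarrow> real ^ 'n) \<Rightarrow> ('m, 'n) cost set \<Rightarrow>
    (('m, 'n) cost \<Rightarrow> real ^ 'm) \<Rightarrow> (('m, 'n) cost \<Rightarrow> real ^ 'n) \<Rightarrow> bool" where
  "positive_definite_costs f V \<eta> \<theta> \<longleftrightarrow>
    (\<forall>L\<in>V. \<theta> L = f (\<theta> L) (\<eta> L) \<and> L (\<eta> L, \<theta> L) = 0 \<and>
      (\<forall>u x. (u, x) \<noteq> (\<eta> L, \<theta> L) \<longrightarrow> L (u, x) > 0)) \<and>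
    (\<exists>\<alpha>. class_K \<alpha> \<and> (\<forall>L\<in>V. \<forall>u x. \<alpha> (norm ((u, x) - (\<eta> L, \<theta> L))) \<le> L (u, x)))"

definition lipschitz_costs :: "('m :: finite, 'n :: finite) cost set \<Rightarrow> bool" where
  "lipschitz_costs V \<longleftrightarrow> (\<exists>l>0. \<forall>L\<in>V. lipschitz_on l UNIV L)"

text \<open>Time 0 counts as a switch.\<close>

definition switches :: "(nat \<Rightarrow> 'c) \<Rightarrow> nat \<Rightarrow> nat \<Rightarrow> nat set" where
  "switches L \<tau>1 \<tau>2 = {t \<in> {\<tau>1..\<tau>2}. t = 0 \<or> L t \<noteq> L (t - 1)}"

definition num_switches :: "(nat \<Rightarrow> 'c) \<Rightarrow> nat \<Rightarrow> nat \<Rightarrow> nat" where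
  "num_switches L \<tau>1 \<tau>2 = card (switches L \<tau>1 \<tau>2)"

text \<open>With \<open>N = num_switches L 0 T\<close>, these are \<open>t\<^sub>0 = 0 < \<dots> < t\<^bsub>N-1\<^esub>\<close> and \<open>t\<^sub>N = T\<close>.\<close>

definition switch_time :: "(nat \<Rightarrow> 'c) \<Rightarrow> nat \<Rightarrow> nat \<Rightarrow> nat" where
  "switch_time L T j =
    (if j < num_switches L 0 T then sorted_list_of_set (switches L 0 T) ! j else T)"

definition average_dwell_time :: "nat \<Rightarrow> real \<Rightarrow> nat \<Rightarrow> (nat \<Rightarrow> 'c) \<Rightarrow> bool" where
  "average_dwell_time N0 \<phi> T L \<longleftrightarrow>
    (\<forall>\<tau>1 \<tau>2. \<tau>1 \<le> \<tau>2 \<and> \<tau>2 \<le> T \<longrightarrow>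
      real (num_switches L \<tau>1 \<tau>2) < real N0 + 1 / \<phi> * real (\<tau>2 - \<tau>1))"

definition admissible_costs ::
  "('m, 'n) cost set \<Rightarrow> nat \<Rightarrow> real \<Rightarrow> nat \<Rightarrow> (nat \<Rightarrow> ('m, 'n) cost) \<Rightarrow> bool" where
  "admissible_costs V N0 \<phi> T L \<longleftrightarrow> (\<forall>t\<le>T. L t \<in> V) \<and> average_dwell_time N0 \<phi> T L"

definition state_convergence ::
  "(real ^ 'n \<Rightarrow> real ^ 'm \<Rightarrow> real ^ 'n) \<Rightarrow> ('m, 'n, 'i) algorithm \<Rightarrow> 'i \<Rightarrow>
    ('m, 'n) cost set \<Rightarrow> (('m, 'n) cost \<Rightarrow> real ^ 'n) \<Rightarrow> real \<Rightarrow> (nat \<Rightarrow> real) \<Rightarrow> bool" where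
  "state_convergence f A i0 V \<theta> k \<sigma> \<longleftrightarrow>
    class_L \<sigma> \<and> \<sigma> 0 = 1 \<and> k \<ge> 1 \<and>
    (\<forall>L\<in>V. \<forall>x u. closed_loop f A i0 (\<lambda>_. L) x u \<longrightarrow>
      (\<forall>t. norm (x t - \<theta> L) \<le> k * norm (x 0 - \<theta> L) * \<sigma> t))"

text \<open>The convergence estimate for a constant cost, restarted after a switch at time \<open>s\<close>: the
  cost stays equal to \<open>L s\<close> from then on, and \<open>x (s + 1)\<close> takes the role of the initial state.
  The base point is \<open>s + 1\<close> because \<open>L s\<close> is unknown to the algorithm when it chooses \<open>u s\<close>.
  Runs that start at time 0 with a constant cost say nothing about an algorithm that
  has already seen another cost (it could stop acting for good), so the restarted
  estimate is not implied by \<open>state_convergence\<close>.\<close>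

definition state_convergence_after_switch ::
  "(real ^ 'n \<Rightarrow> real ^ 'm \<Rightarrow> real ^ 'n) \<Rightarrow> ('m, 'n, 'i) algorithm \<Rightarrow> 'i \<Rightarrow>
    ('m, 'n) cost set \<Rightarrow> (('m, 'n) cost \<Rightarrow> real ^ 'n) \<Rightarrow> nat \<Rightarrow> real \<Rightarrow>
    real \<Rightarrow> (nat \<Rightarrow> real) \<Rightarrow> bool" where
  "state_convergence_after_switch f A i0 V \<theta> N0 \<phi> k \<sigma> \<longleftrightarrow>
    (\<forall>L x u s. (\<forall>T. admissible_costs V N0 \<phi> T L) \<and> closed_loop f A i0 L x u \<and>
        s > 0 \<and> L s \<noteq> L (s - 1) \<and> (\<forall>\<tau>\<ge>s. L \<tau> = L s) \<longrightarrow>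
      (\<forall>t. norm (x (s + 1 + t) - \<theta> (L s)) \<le> k * norm (x (s + 1) - \<theta> (L s)) * \<sigma> t))"

text \<open>\<open>\<phi>l\<close> is a lower bound on the average dwell time which makes the sums of products of
  contraction factors bounded, uniformly in the cost sequence and in the horizon.\<close>

definition dwell_time_threshold ::
  "('m, 'n) cost set \<Rightarrow> nat \<Rightarrow> real \<Rightarrow> (nat \<Rightarrow> real) \<Rightarrow> real \<Rightarrow> bool" where
  "dwell_time_threshold V N0 k \<sigma> \<phi>l \<longleftrightarrow>
    \<phi>l > 0 \<and>
    (\<exists>P>0. \<forall>\<phi>\<ge>\<phi>l. \<forall>T L N'.
      admissible_costs V N0 \<phi> T L \<and> N0 < N' \<and> N' \<le> num_switches L 0 T \<longrightarrow>
      (\<Sum>i=0..N'. \<Prod>j=1..i. k * \<sigma> (switch_time L T j - switch_time L T (j - 1))) \<le> P)"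

text \<open>The truncated subtractions \<open>t - 1\<close>, \<open>t - 2\<close> implement the convention that costs and steady
  states at negative times are those of time 0; the input at time \<open>-1\<close> is \<open>\<eta> (L 0)\<close>.\<close>

definition bounded_inputs ::
  "(real ^ 'n \<Rightarrow> real ^ 'm \<Rightarrow> real ^ 'n) \<Rightarrow> ('m, 'n, 'i) algorithm \<Rightarrow> 'i \<Rightarrow>
    ('m, 'n) cost set \<Rightarrow> (('m, 'n) cost \<Rightarrow> real ^ 'm) \<Rightarrow> (('m, 'n) cost \<Rightarrow> real ^ 'n) \<Rightarrow>
    nat \<Rightarrow> real \<Rightarrow> bool" where
  "bounded_inputs f A i0 V \<eta> \<theta> N0 \<phi> \<longleftrightarrow>
    (\<exists>ku kx kz. 0 \<le> ku \<and> ku < 1 \<and> 0 \<le> kx \<and> 0 \<le> kz \<and>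
      (\<forall>L x u. (\<forall>T. admissible_costs V N0 \<phi> T L) \<and> closed_loop f A i0 L x u \<longrightarrow>
        (\<forall>t. norm (u t - \<eta> (L (t - 1)))
            \<le> ku * norm ((if t = 0 then \<eta> (L 0) else u (t - 1)) - \<eta> (L (t - 1)))
              + kx * norm (x t - \<theta> (L (t - 1)))
              + kz * norm ((\<theta> (L (t - 1)), \<eta> (L (t - 1))) - (\<theta> (L (t - 2)), \<eta> (L (t - 2)))))))"

definition regret ::
  "(('m, 'n) cost \<Rightarrow> real ^ 'm) \<Rightarrow> (('m, 'n) cost \<Rightarrow> real ^ 'n) \<Rightarrow> (nat \<Rightarrow> ('m, 'n) cost) \<Rightarrow>
    (nat \<Rightarrow> real ^ 'n) \<Rightarrow> (nat \<Rightarrow> real ^ 'm) \<Rightarrow> nat \<Rightarrow> real" where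
  "regret \<eta> \<theta> L x u T = (\<Sum>t=0..T. L t (u t, x t) - L t (\<eta> (L t), \<theta> (L t)))"

text \<open>The offset \<open>C\<close> is uniform over all horizons and over all cost sequences whose initial
  tracking error \<open>norm (x0 - \<theta> (L 0))\<close> is at most \<open>r\<close>.  It cannot be uniform over all initial
  costs when \<open>\<theta> ` V\<close> is unbounded, as already the stage cost at time 0 grows with this error;
  when \<open>\<theta> ` V\<close> is bounded, a suitable \<open>r\<close> makes the restriction void.\<close>

definition bounded_dynamic_regret ::
  "(real ^ 'n \<Rightarrow> real ^ 'm \<Rightarrow> real ^ 'n) \<Rightarrow> ('m, 'n, 'i) algorithm \<Rightarrow> 'i \<Rightarrow>
    ('m, 'n) cost set \<Rightarrow> (('m, 'n) cost \<Rightarrow> real ^ 'm) \<Rightarrow> (('m, 'n) cost \<Rightarrow> real ^ 'n) \<Rightarrow>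
    nat \<Rightarrow> real \<Rightarrow> bool" where
  "bounded_dynamic_regret f A i0 V \<eta> \<theta> N0 \<phi> \<longleftrightarrow>
    (\<forall>x0. \<exists>C\<eta>\<ge>0. \<exists>C\<theta>\<ge>0. \<forall>r. \<exists>C\<ge>0. \<forall>T L x u.
      admissible_costs V N0 \<phi> T L \<and> closed_loop f A i0 L x u \<and> x 0 = x0 \<and>
      norm (x0 - \<theta> (L 0)) \<le> r \<longrightarrow>
      regret \<eta> \<theta> L x u T
        \<le> C\<eta> * (\<Sum>t=1..T. norm (\<eta> (L t) - \<eta> (L (t - 1))))
          + C\<theta> * (\<Sum>t=1..T. norm (\<theta> (L t) - \<theta> (L (t - 1)))) + C)"

end

theory Submission
  imports Defs
begin

text \<open>
  By Lipschitz continuity the regret is at most a constant times the summed distances of the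
  states and of the inputs from the moving steady state.

  Between two switches the state decays towards a fixed steady state at the rate \<open>k * \<sigma> t\<close>, measured
  from the error \<open>e i\<close> that it has one step after the switch at the time \<open>\<tau> i\<close>, or initially if
  \<open>i = 0\<close>; since \<open>\<sigma>\<close> is summable,
  the block that follows this switch contributes at most a constant times \<open>e i\<close>
  (\<open>error_decay_after_switch\<close>).  The decay over the whole block, and the jump of the steady state at
  its end, give \<open>e (Suc i) \<le> k * \<sigma> (\<tau> (Suc i) - \<tau> i) * e i + d (Suc i)\<close>, where \<open>d (Suc i)\<close> is the
  length of the jump.  A single factor \<open>k * \<sigma> (\<dots>)\<close> may exceed 1, as switches may come
  close together, but unrolling the recursion produces only sums over \<open>i\<close> of products of consecutive
  factors.  The dwell-time threshold bounds the sums of products that begin with the first factor;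
  discarding the costs before a switch leaves an admissible sequence, so it bounds those that begin
  later as well (\<open>contraction_products_bounded_from\<close>).  Hence the sum of the \<open>e i\<close> is bounded
  by the initial error and the path length of \<open>\<theta>\<close>, and so is the sum of the state errors
  (\<open>sum_state_errors\<close>).

  The input errors satisfy a scalar recursion with the factor \<open>ku < 1\<close>, driven by the state
  errors and the movement of the steady state, so their sum is controlled by the same quantities
  and the path length of \<open>\<eta>\<close> (\<open>sum_input_errors\<close>).
\<close>

section \<open>Closed-loop trajectories and causality\<close>

text \<open>The input at time \<open>t\<close> depends on the entire past, so a trajectory is built by recursion on the
  lists of all states and inputs up to now.\<close>

primrec history ::
  "(real ^ 'n \<Rightarrow> real ^ 'm \<Rightarrow> real ^ 'n) \<Rightarrow> ('m, 'n, 'i) algorithm \<Rightarrow> 'i \<Rightarrow>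
    (nat \<Rightarrow> ('m, 'n) cost) \<Rightarrow> real ^ 'n \<Rightarrow> nat \<Rightarrow> (real ^ 'n) list \<times> (real ^ 'm) list" where
  "history f A i0 L x0 0 = ([x0], [])"
| "history f A i0 L x0 (Suc t) =
    (let (xs, us) = history f A i0 L x0 t; v = A xs us (map L [0..<t]) i0
     in (xs @ [f (last xs) v], us @ [v]))"

lemma closed_loop_exists: "\<exists>x u. closed_loop f A i0 L x u \<and> x 0 = x0"
proof -
  let ?h = "history f A i0 L x0"
  define x where "x t = last (fst (?h t))" for t
  define u where "u t = last (snd (?h (Suc t)))" for t
  have xs: "fst (?h t) = map x [0..<Suc t]" for t
  proof (induction t)
    case (Suc t)
    have "fst (?h (Suc t)) = fst (?h t) @ [x (Suc t)]"
      by (simp add: x_def Let_def split: prod.splits)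
    then show ?case using Suc by simp
  qed (simp add: x_def)
  have us: "snd (?h t) = map u [0..<t]" for t
  proof (induction t)
    case (Suc t)
    have "snd (?h (Suc t)) = snd (?h t) @ [u t]"
      by (simp add: u_def Let_def split: prod.splits)
    then show ?case using Suc by simp
  qed simp
  have u_eq: "u t = A (fst (?h t)) (snd (?h t)) (map L [0..<t]) i0" for t
    by (simp add: u_def Let_def split: prod.splits)
  have x_eq: "x (Suc t) = f (x t) (A (fst (?h t)) (snd (?h t)) (map L [0..<t]) i0)" for t
    by (simp add: x_def Let_def split: prod.splits)
  have "closed_loop f A i0 L x u"
    unfolding closed_loop_def using u_eq x_eq by (metis xs us)
  moreover have "x 0 = x0" by (simp add: x_def)
  ultimately show ?thesis by blast
qed

lemma closed_loop_causal:
  assumes cl: "closed_loop f A i0 L x u" "closed_loop f A i0 L' x' u'"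
    and x0: "x' 0 = x 0" and L: "\<And>t. t < b \<Longrightarrow> L' t = L t"
  shows "t \<le> b \<Longrightarrow> u' t = u t" and "t \<le> Suc b \<Longrightarrow> x' t = x t"
proof -
  have agree: "(\<forall>s\<le>t. x' s = x s) \<and> (\<forall>s<t. u' s = u s)" if "t \<le> Suc b" for t
    using that
  proof (induction t)
    case (Suc t)
    then have IH: "\<forall>s\<le>t. x' s = x s" "\<forall>s<t. u' s = u s" by auto
    have "map x' [0..<Suc t] = map x [0..<Suc t]" "map u' [0..<t] = map u [0..<t]"
      "map L' [0..<t] = map L [0..<t]"
      using IH L Suc.prems by auto
    then have "u' t = u t" using cl unfolding closed_loop_def by metis
    moreover from this have "x' (Suc t) = x (Suc t)"
      using cl IH(1) unfolding closed_loop_def by simp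
    ultimately show ?case using IH by (auto simp: le_Suc_eq less_Suc_eq)
  qed (simp add: x0)
  show "t \<le> b \<Longrightarrow> u' t = u t" using agree[of "Suc t"] by simp
  show "t \<le> Suc b \<Longrightarrow> x' t = x t" using agree[of t] by simp
qed

text \<open>The hypotheses of the theorem speak of cost sequences that are admissible on every horizon,
  or that never switch again.  Causality makes them usable for a sequence that is admissible only
  up to a horizon: change the future of the sequence, run the algorithm on the result, and
  carry the estimate back over the time span on which the two runs coincide.\<close>

lemma closed_loop_change_future:
  assumes "closed_loop f A i0 L x u" and "\<And>t. t < b \<Longrightarrow> L' t = L t"
  obtains x' u' where "closed_loop f A i0 L' x' u'"
    and "\<forall>t\<le>b. u' t = u t" and "\<forall>t\<le>Suc b. x' t = x t"
proof -
  obtain x' u' where cl: "closed_loop f A i0 L' x' u'" and "x' 0 = x 0"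
    using closed_loop_exists[of f A i0 L' "x 0"] by blast
  show thesis
    using closed_loop_causal[OF assms(1) cl \<open>x' 0 = x 0\<close> assms(2)] by (intro that[OF cl]) auto
qed

section \<open>Switching times\<close>

lemma finite_switches [simp]: "finite (switches L a b)"
  by (simp add: switches_def)

lemma switch_time_strict_mono:
  assumes "i < j" "j < num_switches L 0 T"
  shows "switch_time L T i < switch_time L T j"
  using assms sorted_wrt_nth_less[OF strict_sorted_list_of_set, of i j "switches L 0 T"]
  by (simp add: switch_time_def num_switches_def)

lemma switch_time_in_switches:
  assumes "j < num_switches L 0 T"
  shows "switch_time L T j \<in> switches L 0 T"
proof -
  have "sorted_list_of_set (switches L 0 T) ! j \<in> set (sorted_list_of_set (switches L 0 T))"
    using assms by (intro nth_mem) (simp add: num_switches_def)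
  then show ?thesis using assms by (simp add: switch_time_def)
qed

lemma switch_time_surj:
  assumes "t \<in> switches L 0 T"
  obtains j where "j < num_switches L 0 T" "switch_time L T j = t"
proof -
  have "t \<in> set (sorted_list_of_set (switches L 0 T))" using assms by simp
  then obtain j where "j < num_switches L 0 T" "sorted_list_of_set (switches L 0 T) ! j = t"
    unfolding in_set_conv_nth num_switches_def by auto
  then show thesis using that[of j] by (simp add: switch_time_def)
qed

lemma num_switches_pos: "0 < num_switches L 0 T"
proof -
  have "0 \<in> switches L 0 T" by (simp add: switches_def)
  then show ?thesis unfolding num_switches_def by (auto simp: card_gt_0_iff)
qed

lemma switch_time_0 [simp]: "switch_time L T 0 = 0"
proof -
  have "0 \<in> switches L 0 T" by (simp add: switches_def)
  then obtain j where "j < num_switches L 0 T" "switch_time L T j = 0"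
    by (rule switch_time_surj)
  then show ?thesis using switch_time_strict_mono[of 0 j L T] by (cases j) auto
qed

lemma switch_time_le: "switch_time L T j \<le> T"
proof (cases "j < num_switches L 0 T")
  case True
  then show ?thesis using switch_time_in_switches[of j L T] by (simp add: switches_def)
qed (simp add: switch_time_def)

lemma switch_time_step_le: "switch_time L T j \<le> switch_time L T (Suc j)"
proof (cases "Suc j < num_switches L 0 T")
  case True
  then show ?thesis using switch_time_strict_mono[of j "Suc j" L T] by simp
next
  case False
  then show ?thesis using switch_time_le[of L T j] by (simp add: switch_time_def)
qed

lemma cost_constant_between_switches:
  assumes j: "j < num_switches L 0 T" and "switch_time L T j \<le> t" "t \<le> T"
    and "Suc j < num_switches L 0 T \<Longrightarrow> t < switch_time L T (Suc j)"
  shows "L t = L (switch_time L T j)"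
  using assms(2-4)
proof (induction t rule: dec_induct)
  case (step n)
  have "Suc n \<notin> switches L 0 T"
  proof
    assume "Suc n \<in> switches L 0 T"
    then obtain i where i: "i < num_switches L 0 T" "switch_time L T i = Suc n"
      by (rule switch_time_surj)
    have "\<not> i \<le> j"
      using switch_time_strict_mono[of i j L T] j i step.hyps by (cases "i = j") auto
    then have "Suc j \<le> i" by simp
    then have "switch_time L T (Suc j) \<le> Suc n"
      using switch_time_strict_mono[of "Suc j" i L T] i by (cases "Suc j = i") auto
    then show False using step.prems i \<open>Suc j \<le> i\<close> by auto
  qed
  then have "L (Suc n) = L n" using step.prems by (simp add: switches_def)
  moreover have "L n = L (switch_time L T j)"
  proof (rule step.IH)
    show "n \<le> T" using step.prems(1) by simp
    show "n < switch_time L T (Suc j)" if "Suc j < num_switches L 0 T"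
      using step.prems(2)[OF that] by simp
  qed
  ultimately show ?case by simp
qed simp

text \<open>A switch remains a switch when it becomes time 0, since time 0 always counts.  Hence
  discarding the costs before a switch keeps that switch and all later ones, up to the translation;
  a cut at any other time would create a spurious switch.\<close>

lemma switches_shift:
  assumes "a = 0 \<or> L a \<noteq> L (a - 1)"
  shows "switches (\<lambda>t. L (a + t)) b c = (\<lambda>t. t - a) ` switches L (a + b) (a + c)"
proof -
  have iff: "(t = 0 \<or> L (a + t) \<noteq> L (a + (t - 1))) \<longleftrightarrow> (a + t = 0 \<or> L (a + t) \<noteq> L (a + t - 1))" for t
    using assms by (cases t) auto
  show ?thesis
  proof (intro equalityI subsetI)
    fix t assume "t \<in> switches (\<lambda>t. L (a + t)) b c"
    then have "a + t \<in> switches L (a + b) (a + c)" using iff[of t] by (simp add: switches_def)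
    then show "t \<in> (\<lambda>t. t - a) ` switches L (a + b) (a + c)" by (force intro: rev_image_eqI)
  next
    fix t assume "t \<in> (\<lambda>t. t - a) ` switches L (a + b) (a + c)"
    then obtain s where s: "s \<in> switches L (a + b) (a + c)" "t = s - a" by auto
    then have "s = a + t" by (auto simp: switches_def)
    then show "t \<in> switches (\<lambda>t. L (a + t)) b c" using iff[of t] s by (auto simp: switches_def)
  qed
qed

lemma num_switches_shift:
  assumes "a = 0 \<or> L a \<noteq> L (a - 1)"
  shows "num_switches (\<lambda>t. L (a + t)) b c = num_switches L (a + b) (a + c)"
  unfolding num_switches_def switches_shift[where L = L, OF assms]
  by (rule card_image) (auto simp: inj_on_def switches_def)

lemma switch_list_shift:
  assumes m: "m < num_switches L 0 T" and a: "a = switch_time L T m"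
  shows "sorted_list_of_set (switches (\<lambda>t. L (a + t)) 0 (T - a)) =
    map (\<lambda>t. t - a) (drop m (sorted_list_of_set (switches L 0 T)))" (is "_ = map _ (drop m ?xs)")
proof -
  have aS: "a \<in> switches L 0 T" using switch_time_in_switches[OF m] a by simp
  then have aT: "a \<le> T" and asw: "a = 0 \<or> L a \<noteq> L (a - 1)" by (auto simp: switches_def)
  have len: "length ?xs = num_switches L 0 T" by (simp add: num_switches_def)
  have nth: "?xs ! j = switch_time L T j" if "j < num_switches L 0 T" for j
    using that by (simp add: switch_time_def)
  have set_drop: "set (drop m ?xs) = switches L a T"
  proof (intro equalityI subsetI)
    fix t assume "t \<in> set (drop m ?xs)"
    then obtain i where "i < length (drop m ?xs)" "t = drop m ?xs ! i"
      by (metis in_set_conv_nth)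
    then have i: "m + i < num_switches L 0 T" "t = switch_time L T (m + i)"
      using m len nth[of "m + i"] by auto
    then have "a \<le> t" using a switch_time_strict_mono[of m "m + i" L T] by (cases "i = 0") auto
    then show "t \<in> switches L a T"
      using switch_time_in_switches[OF i(1)] i(2) by (simp add: switches_def)
  next
    fix t assume t: "t \<in> switches L a T"
    then have "t \<in> switches L 0 T" by (simp add: switches_def)
    then obtain j where j: "j < num_switches L 0 T" "switch_time L T j = t"
      by (rule switch_time_surj)
    have "m \<le> j"
      using switch_time_strict_mono[of j m L T] m a j t by (force simp: switches_def not_le)
    then have "drop m ?xs ! (j - m) = t" "j - m < length (drop m ?xs)"
      using j len nth[OF j(1)] by auto
    then show "t \<in> set (drop m ?xs)" using nth_mem by blast
  qed
  have strict: "sorted_wrt (<) (map (\<lambda>t. t - a) (drop m ?xs))"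
  proof -
    have "sorted_wrt (<) (drop m ?xs)"
      by (rule sorted_wrt_drop) (rule strict_sorted_list_of_set)
    moreover have "\<forall>t\<in>set (drop m ?xs). a \<le> t" unfolding set_drop by (simp add: switches_def)
    ultimately show ?thesis
      unfolding sorted_wrt_map
      by (elim sorted_wrt_mono_rel[rotated]) (simp add: diff_less_mono)
  qed
  have "set (map (\<lambda>t. t - a) (drop m ?xs)) = switches (\<lambda>t. L (a + t)) 0 (T - a)"
    using switches_shift[where L = L, OF asw, of 0 "T - a"] aT set_drop by simp
  moreover have "sorted (map (\<lambda>t. t - a) (drop m ?xs))" "distinct (map (\<lambda>t. t - a) (drop m ?xs))"
    using strict by (simp_all only: strict_sorted_iff)
  ultimately show ?thesis
    using sorted_list_of_set.idem_if_sorted_distinct by metis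
qed

lemma switch_time_shift:
  assumes m: "m < num_switches L 0 T" and a: "a = switch_time L T m"
  shows "num_switches (\<lambda>t. L (a + t)) 0 (T - a) = num_switches L 0 T - m"
    and "m + j < num_switches L 0 T \<Longrightarrow>
      switch_time (\<lambda>t. L (a + t)) (T - a) j = switch_time L T (m + j) - a"
proof -
  note list = switch_list_shift[OF m a]
  show num: "num_switches (\<lambda>t. L (a + t)) 0 (T - a) = num_switches L 0 T - m"
    using arg_cong[OF list, of length] by (simp add: num_switches_def)
  assume "m + j < num_switches L 0 T"
  then show "switch_time (\<lambda>t. L (a + t)) (T - a) j = switch_time L T (m + j) - a"
    unfolding switch_time_def num using list m by (simp add: num_switches_def add.commute)
qed

section \<open>Admissible cost sequences\<close>

lemma admissible_costs_shift:
  assumes "admissible_costs V N0 \<phi> T L" and "a \<in> switches L 0 T"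
  shows "admissible_costs V N0 \<phi> (T - a) (\<lambda>t. L (a + t))"
proof -
  have a: "a \<le> T" "a = 0 \<or> L a \<noteq> L (a - 1)" using assms(2) by (auto simp: switches_def)
  have "real (num_switches L (a + b) (a + c)) < real N0 + 1 / \<phi> * real (c - b)"
    if "b \<le> c" "c \<le> T - a" for b c
  proof -
    have "a + b \<le> a + c" "a + c \<le> T" using that a by auto
    then have "real (num_switches L (a + b) (a + c)) < real N0 + 1 / \<phi> * real ((a + c) - (a + b))"
      using assms(1) unfolding admissible_costs_def average_dwell_time_def by blast
    then show ?thesis by simp
  qed
  then show ?thesis
    using assms(1) a unfolding admissible_costs_def average_dwell_time_def
    by (simp add: num_switches_shift[where L = L, OF a(2)])
qed

text \<open>Freezing the cost from time \<open>s\<close> on only removes switches.  The one point to check is the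
  strict inequality on intervals of length 0 without a switch: it needs \<open>N0 > 0\<close>, which
  the interval \<open>{0..0}\<close> provides, since it contains the switch at time 0.\<close>

lemma admissible_costs_freeze:
  assumes adm: "admissible_costs V N0 \<phi> T L" and "\<phi> > 0" and "s \<le> T"
  shows "admissible_costs V N0 \<phi> T' (\<lambda>t. L (min t s))"
proof -
  have adt: "real (num_switches L a b) < real N0 + 1 / \<phi> * real (b - a)" if "a \<le> b" "b \<le> T" for a b
    using adm that unfolding admissible_costs_def average_dwell_time_def by blast
  have N0: "real N0 > 0" using adt[of 0 0] num_switches_pos[of L 0] by simp
  have "real (num_switches (\<lambda>t. L (min t s)) a b) < real N0 + 1 / \<phi> * real (b - a)"
    if "a \<le> b" for a b
  proof (cases "a \<le> s")
    case True
    have "switches (\<lambda>t. L (min t s)) a b \<subseteq> switches L a (min b s)"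
    proof
      fix t assume t: "t \<in> switches (\<lambda>t. L (min t s)) a b"
      show "t \<in> switches L a (min b s)"
      proof (cases "t \<le> s")
        case True
        then have "min (t - 1) s = t - 1" by simp
        with True t show ?thesis by (simp add: switches_def)
      next
        case False
        then have "min t s = s" "min (t - 1) s = s" by auto
        with False t show ?thesis by (simp add: switches_def)
      qed
    qed
    then have "num_switches (\<lambda>t. L (min t s)) a b \<le> num_switches L a (min b s)"
      unfolding num_switches_def by (intro card_mono) auto
    moreover have "real (num_switches L a (min b s)) < real N0 + 1 / \<phi> * real (min b s - a)"
      using True that \<open>s \<le> T\<close> by (intro adt) auto
    moreover have "1 / \<phi> * real (min b s - a) \<le> 1 / \<phi> * real (b - a)"
      using \<open>\<phi> > 0\<close> by (intro mult_left_mono) auto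
    ultimately show ?thesis by linarith
  next
    case False
    have "t \<notin> switches (\<lambda>t. L (min t s)) a b" for t
    proof
      assume t: "t \<in> switches (\<lambda>t. L (min t s)) a b"
      then have "a \<le> t" by (simp add: switches_def)
      then have "t \<noteq> 0" "min t s = s" "min (t - 1) s = s" using False by auto
      then show False using t by (simp add: switches_def)
    qed
    then have "switches (\<lambda>t. L (min t s)) a b = {}" by blast
    then have "num_switches (\<lambda>t. L (min t s)) a b = 0" by (simp add: num_switches_def)
    then show ?thesis using N0 \<open>\<phi> > 0\<close> by (simp add: add_pos_nonneg)
  qed
  then show ?thesis
    using adm \<open>s \<le> T\<close> unfolding admissible_costs_def average_dwell_time_def by simp
qed

section \<open>Decay of the tracking error between two switches\<close>

text \<open>The error from which the decay towards the steady state of a cost introduced at time \<open>s\<close> is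
  measured.  The algorithm does not know the cost at time \<open>s\<close> when it chooses the input there, so
  for \<open>s > 0\<close> the decay starts only at \<open>Suc s\<close>; for \<open>s = 0\<close> the convergence assumption starts
  at the initial state.\<close>

definition restart_error ::
  "(('m, 'n) cost \<Rightarrow> real ^ 'n) \<Rightarrow> (nat \<Rightarrow> ('m, 'n) cost) \<Rightarrow> (nat \<Rightarrow> real ^ 'n) \<Rightarrow> nat \<Rightarrow> real" where
  "restart_error \<theta> L x s = norm (x (if s = 0 then 0 else Suc s) - \<theta> (L s))"

text \<open>The run with the cost frozen at \<open>L s\<close> obeys the convergence assumption and coincides with the
  actual run until the next switch.  The estimate reaches one step beyond the block, to
  \<open>t = Suc b\<close> if \<open>b\<close> is the next switching time, because the input at \<open>b\<close> is still chosen without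
  knowledge of the new cost; that step links consecutive restart errors.  For \<open>s = 0\<close> the decay is
  in fact one step ahead, and the common form loses this step by monotonicity of \<open>\<sigma>\<close>.\<close>

lemma error_decay_after_switch:
  assumes sc: "state_convergence f A i0 V \<theta> k \<sigma>"
    and after: "state_convergence_after_switch f A i0 V \<theta> N0 \<phi> k \<sigma>"
    and "\<phi> > 0" and adm: "admissible_costs V N0 \<phi> T L" and cl: "closed_loop f A i0 L x u"
    and s: "s \<in> switches L 0 T" and const: "\<And>t. s \<le> t \<Longrightarrow> t < b \<Longrightarrow> L t = L s"
    and t: "s < t" "t \<le> Suc b"
  shows "norm (x t - \<theta> (L s)) \<le> k * restart_error \<theta> L x s * \<sigma> (t - Suc s)"
proof -
  define L' where "L' = (\<lambda>\<tau>. L (min \<tau> s))"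
  have "L' \<tau> = L \<tau>" if "\<tau> < b" for \<tau>
    using const[of \<tau>] that by (simp add: L'_def min_def)
  then obtain x' u' where cl': "closed_loop f A i0 L' x' u'"
    and x': "\<forall>t\<le>Suc b. x' t = x t"
    by (rule closed_loop_change_future[OF cl]) blast
  have "s \<le> T" using s by (simp add: switches_def)
  have k: "k \<ge> 1" "antimono \<sigma>" using sc by (auto simp: state_convergence_def class_L_def)
  show ?thesis
  proof (cases "s = 0")
    case True
    have "L' = (\<lambda>_. L 0)" using True by (simp add: L'_def)
    moreover have "L 0 \<in> V" using adm by (simp add: admissible_costs_def)
    ultimately have "norm (x' t - \<theta> (L 0)) \<le> k * norm (x' 0 - \<theta> (L 0)) * \<sigma> t"
      using sc cl' unfolding state_convergence_def by blast
    also have "\<dots> \<le> k * norm (x' 0 - \<theta> (L 0)) * \<sigma> (t - 1)"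
      using k(1) antimonoD[OF k(2), of "t - 1" t] by (intro mult_left_mono) auto
    finally show ?thesis using True x' t by (simp add: restart_error_def)
  next
    case False
    have "\<forall>T. admissible_costs V N0 \<phi> T L'"
      unfolding L'_def using admissible_costs_freeze[OF adm \<open>\<phi> > 0\<close> \<open>s \<le> T\<close>] by blast
    moreover have "L' s \<noteq> L' (s - 1)" using s False by (auto simp: L'_def switches_def min_def)
    moreover have "\<forall>\<tau>\<ge>s. L' \<tau> = L' s" by (simp add: L'_def)
    ultimately have "norm (x' (s + 1 + (t - Suc s)) - \<theta> (L' s))
        \<le> k * norm (x' (s + 1) - \<theta> (L' s)) * \<sigma> (t - Suc s)"
      using after cl' False unfolding state_convergence_after_switch_def by blast
    moreover have "s + 1 + (t - Suc s) = t" "L' s = L s" using t by (auto simp: L'_def)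
    ultimately show ?thesis
      using False x' t by (simp add: restart_error_def)
  qed
qed

section \<open>Summing the restart errors\<close>

text \<open>A discrete Gronwall inequality: each disturbance \<open>d m\<close> is carried to every later \<open>i\<close> with the
  product of the factors in between as its weight, and exchanging the order of summation collects
  the total weight of \<open>d m\<close>.  It involves sums of products only, so individual factors may
  exceed 1.\<close>

lemma sum_contraction_recursion:
  fixes e c d :: "nat \<Rightarrow> real"
  assumes c: "\<And>j. 0 \<le> c j" and d: "\<And>j. 0 \<le> d j" and e0: "e 0 \<le> d 0"
    and rec: "\<And>i. Suc i < N \<Longrightarrow> e (Suc i) \<le> c (Suc i) * e i + d (Suc i)"
    and Q: "\<And>m. m < N \<Longrightarrow> (\<Sum>i=m..<N. \<Prod>j\<in>{m<..i}. c j) \<le> Q"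
  shows "(\<Sum>i<N. e i) \<le> Q * (\<Sum>m<N. d m)"
proof -
  define g where "g i m = (\<Prod>j\<in>{m<..i}. c j) * d m" for i m
  have unroll: "e i \<le> (\<Sum>m\<le>i. g i m)" if "i < N" for i
    using that
  proof (induction i)
    case (Suc i)
    have "g (Suc i) m = c (Suc i) * g i m" if "m \<le> i" for m
    proof -
      have "{m<..Suc i} = insert (Suc i) {m<..i}" using that by auto
      then show ?thesis by (simp add: g_def)
    qed
    then have step: "(\<Sum>m\<le>i. g (Suc i) m) = c (Suc i) * (\<Sum>m\<le>i. g i m)"
      by (simp add: sum_distrib_left)
    have "e (Suc i) \<le> c (Suc i) * e i + d (Suc i)" using rec Suc.prems by simp
    also have "\<dots> \<le> c (Suc i) * (\<Sum>m\<le>i. g i m) + d (Suc i)"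
      using Suc c by (intro add_right_mono mult_left_mono) auto
    also have "\<dots> = (\<Sum>m\<le>Suc i. g (Suc i) m)" using step by (simp add: g_def)
    finally show ?case .
  qed (simp add: g_def e0)
  have "(\<Sum>i<N. e i) \<le> (\<Sum>i<N. \<Sum>m\<le>i. g i m)" using unroll by (intro sum_mono) auto
  also have "\<dots> = (\<Sum>i\<in>{..<N}. \<Sum>m\<in>{m\<in>{..<N}. m \<le> i}. g i m)"
    by (intro sum.cong) auto
  also have "\<dots> = (\<Sum>m\<in>{..<N}. \<Sum>i\<in>{i\<in>{..<N}. m \<le> i}. g i m)"
    by (rule sum.swap_restrict) auto
  also have "\<dots> = (\<Sum>m<N. \<Sum>i=m..<N. g i m)" by (intro sum.cong) auto
  also have "\<dots> = (\<Sum>m<N. (\<Sum>i=m..<N. \<Prod>j\<in>{m<..i}. c j) * d m)"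
    by (simp add: g_def sum_distrib_right)
  also have "\<dots> \<le> (\<Sum>m<N. Q * d m)" using Q d by (intro sum_mono mult_right_mono) auto
  finally show ?thesis by (simp add: sum_distrib_left)
qed

text \<open>The threshold covers only sequences with more than \<open>N0\<close> switches.  For the others there are at
  most \<open>N0\<close> summands, and each factor is at most \<open>k\<close>.\<close>

lemma contraction_products_bounded:
  assumes sc: "state_convergence f A i0 V \<theta> k \<sigma>"
    and thr: "dwell_time_threshold V N0 k \<sigma> \<phi>l" and "\<phi> \<ge> \<phi>l"
  shows "\<exists>Q\<ge>0. \<forall>T L. admissible_costs V N0 \<phi> T L \<longrightarrow>
    (\<Sum>i<num_switches L 0 T. \<Prod>j=1..i. k * \<sigma> (switch_time L T j - switch_time L T (j - 1))) \<le> Q"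
proof -
  have k: "k \<ge> 1" and \<sigma>: "\<And>t. 0 \<le> \<sigma> t" "antimono \<sigma>" "\<sigma> 0 = 1"
    using sc by (auto simp: state_convergence_def class_L_def)
  have \<sigma>1: "\<sigma> t \<le> 1" for t using antimonoD[OF \<sigma>(2), of 0 t] \<sigma>(3) by simp
  obtain P where "P > 0" and P: "\<And>T L N'. admissible_costs V N0 \<phi> T L \<Longrightarrow> N0 < N' \<Longrightarrow>
      N' \<le> num_switches L 0 T \<Longrightarrow>
      (\<Sum>i=0..N'. \<Prod>j=1..i. k * \<sigma> (switch_time L T j - switch_time L T (j - 1))) \<le> P"
    using thr \<open>\<phi> \<ge> \<phi>l\<close> unfolding dwell_time_threshold_def by blast
  define R where "R = (\<Sum>i\<le>N0. k ^ i)"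
  have "R \<ge> 0" unfolding R_def using k by (intro sum_nonneg) auto
  have "(\<Sum>i<num_switches L 0 T. \<Prod>j=1..i. k * \<sigma> (switch_time L T j - switch_time L T (j - 1)))
      \<le> P + R" if adm: "admissible_costs V N0 \<phi> T L" for T L
  proof -
    let ?N = "num_switches L 0 T"
    let ?p = "\<lambda>i. \<Prod>j=1..i. k * \<sigma> (switch_time L T j - switch_time L T (j - 1))"
    have p0: "0 \<le> ?p i" for i using k \<sigma> by (intro prod_nonneg) auto
    show ?thesis
    proof (cases "N0 < ?N")
      case True
      have "sum ?p {..<?N} \<le> sum ?p {0..?N}" using p0 by (intro sum_mono2) auto
      also have "\<dots> \<le> P" using P[OF adm True] by simp
      finally show ?thesis using \<open>R \<ge> 0\<close> by simp
    next
      case False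
      have "?p i \<le> k ^ i" for i
      proof -
        have "?p i \<le> (\<Prod>j=1..i. k)"
          using k \<sigma> \<sigma>1 by (intro prod_mono) (auto intro: mult_left_le)
        then show ?thesis by simp
      qed
      then have "sum ?p {..<?N} \<le> (\<Sum>i<?N. k ^ i)" by (intro sum_mono)
      also have "\<dots> \<le> R" unfolding R_def using k False by (intro sum_mono2) auto
      finally show ?thesis using \<open>P > 0\<close> by simp
    qed
  qed
  then show ?thesis using \<open>P > 0\<close> \<open>R \<ge> 0\<close> by (intro exI[of _ "P + R"]) auto
qed

text \<open>The products that begin after the switch number \<open>m\<close> are the products of all factors for the
  sequence that forgets the costs before that switch.\<close>

lemma contraction_products_bounded_from:
  assumes Q: "\<And>T L. admissible_costs V N0 \<phi> T L \<Longrightarrow>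
      (\<Sum>i<num_switches L 0 T. \<Prod>j=1..i. k * \<sigma> (switch_time L T j - switch_time L T (j - 1))) \<le> Q"
    and adm: "admissible_costs V N0 \<phi> T L" and m: "m < num_switches L 0 T"
  shows "(\<Sum>i=m..<num_switches L 0 T. \<Prod>j\<in>{m<..i}.
      k * \<sigma> (switch_time L T j - switch_time L T (j - 1))) \<le> Q"
proof -
  let ?N = "num_switches L 0 T" and ?c = "\<lambda>j. k * \<sigma> (switch_time L T j - switch_time L T (j - 1))"
  define a where "a = switch_time L T m"
  let ?L = "\<lambda>t. L (a + t)"
  let ?c' = "\<lambda>j. k * \<sigma> (switch_time ?L (T - a) j - switch_time ?L (T - a) (j - 1))"
  note shift = switch_time_shift[OF m a_def]
  have prod: "(\<Prod>j\<in>{m<..m + i}. ?c j) = (\<Prod>j=1..i. ?c' j)" if "m + i < ?N" for i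
  proof (rule prod.reindex_bij_witness[of _ "\<lambda>j. m + j" "\<lambda>j. j - m"])
    fix j assume "j \<in> {m<..m + i}"
    then have "m < j" "j < ?N" using that by auto
    then obtain l where l: "j = m + Suc l" "m + Suc l < ?N"
      using less_imp_Suc_add[of m j] by auto
    have "a \<le> switch_time L T (m + l)"
      unfolding a_def using switch_time_strict_mono[of m "m + l" L T] l by (cases "l = 0") auto
    then show "?c' (j - m) = ?c j" using l by (simp add: shift(2))
  qed auto
  have "(\<Sum>i=m..<?N. \<Prod>j\<in>{m<..i}. ?c j) = (\<Sum>i<?N - m. \<Prod>j\<in>{m<..m + i}. ?c j)"
    by (rule sum.reindex_bij_witness[of _ "\<lambda>i. m + i" "\<lambda>i. i - m"]) auto
  also have "\<dots> = (\<Sum>i<num_switches ?L 0 (T - a). \<Prod>j=1..i. ?c' j)"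
    unfolding shift(1) using prod by (intro sum.cong) auto
  also have "\<dots> \<le> Q"
    using Q admissible_costs_shift[OF adm] switch_time_in_switches[OF m] unfolding a_def by blast
  finally show ?thesis .
qed

section \<open>Summed state and input errors\<close>

lemma sum_over_blocks:
  fixes g :: "nat \<Rightarrow> 'a :: comm_monoid_add" and \<tau> :: "nat \<Rightarrow> nat"
  assumes "\<And>i. \<tau> i \<le> \<tau> (Suc i)"
  shows "sum g {\<tau> 0<..\<tau> n} = (\<Sum>i<n. sum g {\<tau> i<..\<tau> (Suc i)})"
proof (induction n)
  case (Suc n)
  have "\<tau> 0 \<le> \<tau> n" using lift_Suc_mono_le[of \<tau> 0 n] assms by simp
  then have "{\<tau> 0<..\<tau> (Suc n)} = {\<tau> 0<..\<tau> n} \<union> {\<tau> n<..\<tau> (Suc n)}"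
    using assms[of n] by auto
  then have "sum g {\<tau> 0<..\<tau> (Suc n)} = sum g {\<tau> 0<..\<tau> n} + sum g {\<tau> n<..\<tau> (Suc n)}"
    by (simp add: sum.union_disjoint)
  then show ?case using Suc by simp
qed simp

text \<open>The state at time \<open>t\<close> is compared with the steady state at time \<open>t - 1\<close>, that of the last cost the
  algorithm has seen.  With this delay, the blocks are the intervals \<open>{\<tau> i<..\<tau> (Suc i)}\<close>, which begin
  exactly where the decay begins.\<close>

lemma sum_state_errors:
  assumes sc: "state_convergence f A i0 V \<theta> k \<sigma>"
    and after: "state_convergence_after_switch f A i0 V \<theta> N0 \<phi> k \<sigma>"
    and "\<phi> > 0" and adm: "admissible_costs V N0 \<phi> T L" and cl: "closed_loop f A i0 L x u"
    and S: "\<And>n. (\<Sum>t<n. \<sigma> t) \<le> S"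
    and Q: "\<And>T L. admissible_costs V N0 \<phi> T L \<Longrightarrow>
      (\<Sum>i<num_switches L 0 T. \<Prod>j=1..i. k * \<sigma> (switch_time L T j - switch_time L T (j - 1))) \<le> Q"
  shows "(\<Sum>t=1..T. norm (x t - \<theta> (L (t - 1))))
    \<le> k * S * Q * (norm (x 0 - \<theta> (L 0)) + (\<Sum>t=1..T. norm (\<theta> (L t) - \<theta> (L (t - 1)))))"
proof -
  define N where "N = num_switches L 0 T"
  define \<tau> where "\<tau> = switch_time L T"
  define e where "e i = restart_error \<theta> L x (\<tau> i)" for i
  define \<delta> where "\<delta> t = norm (\<theta> (L t) - \<theta> (L (t - 1)))" for t
  define d where "d i = (if i = 0 then norm (x 0 - \<theta> (L 0)) else \<delta> (\<tau> i))" for i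
  have k: "k \<ge> 1" and \<sigma>: "\<And>t. 0 \<le> \<sigma> t"
    using sc by (auto simp: state_convergence_def class_L_def)
  have N: "0 < N" by (simp add: N_def num_switches_pos)
  have \<tau>0: "\<tau> 0 = 0" and \<tau>N: "\<tau> N = T" by (auto simp: \<tau>_def N_def switch_time_def[of _ _ "num_switches _ _ _"])
  have \<tau>sw: "\<tau> i \<in> switches L 0 T" if "i < N" for i
    using that by (simp add: \<tau>_def N_def switch_time_in_switches)
  have \<tau>less: "\<tau> i < \<tau> j" if "i < j" "j < N" for i j
    using that by (simp add: \<tau>_def N_def switch_time_strict_mono)
  have \<tau>le: "\<tau> i \<le> \<tau> (Suc i)" for i by (simp add: \<tau>_def switch_time_step_le)
  have \<tau>T: "\<tau> i \<le> T" for i by (simp add: \<tau>_def switch_time_le)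
  have S0: "S \<ge> 0" using S[of 0] by simp
  have const: "L t = L (\<tau> i)" if "i < N" "\<tau> i \<le> t" "t < \<tau> (Suc i)" for i t
    unfolding \<tau>_def
  proof (rule cost_constant_between_switches)
    show "t \<le> T" using that \<tau>T[of "Suc i"] by linarith
  qed (use that in \<open>auto simp: N_def \<tau>_def\<close>)
  have decay: "norm (x t - \<theta> (L (\<tau> i))) \<le> k * e i * \<sigma> (t - Suc (\<tau> i))"
    if "i < N" "\<tau> i < t" "t \<le> Suc (\<tau> (Suc i))" for i t
    unfolding e_def
    using error_decay_after_switch[OF sc after \<open>\<phi> > 0\<close> adm cl \<tau>sw[OF that(1)] const[OF that(1)]]
      that by blast

  \<comment> \<open>The initial error plays the role of a jump at the switch number 0.\<close>
  have "(\<Sum>i<N. e i) \<le> Q * (\<Sum>m<N. d m)"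
  proof (rule sum_contraction_recursion[where c = "\<lambda>j. k * \<sigma> (\<tau> j - \<tau> (j - 1))"])
    fix i assume i: "Suc i < N"
    let ?s = "\<tau> i" and ?s' = "\<tau> (Suc i)"
    have s': "?s < ?s'" using \<tau>less[of i "Suc i"] i by simp
    have "norm (x (Suc ?s') - \<theta> (L ?s)) \<le> k * e i * \<sigma> (?s' - ?s)"
      using decay[of i "Suc ?s'"] i s' by simp
    moreover have "norm (x (Suc ?s') - \<theta> (L ?s'))
        \<le> norm (x (Suc ?s') - \<theta> (L ?s)) + norm (\<theta> (L ?s') - \<theta> (L ?s))"
      by (metis norm_minus_commute norm_diff_triangle_le order_refl)
    moreover have "L ?s = L (?s' - 1)" using const[of i "?s' - 1"] i s' by simp
    ultimately show "e (Suc i) \<le> k * \<sigma> (\<tau> (Suc i) - \<tau> (Suc i - 1)) * e i + d (Suc i)"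
      using s' by (simp add: e_def restart_error_def d_def \<delta>_def mult_ac)
  next
    fix m assume "m < N"
    then show "(\<Sum>i=m..<N. \<Prod>j\<in>{m<..i}. k * \<sigma> (\<tau> j - \<tau> (j - 1))) \<le> Q"
      using contraction_products_bounded_from[where \<sigma> = \<sigma> and k = k, OF Q adm]
      unfolding N_def \<tau>_def by blast
  qed (use k \<sigma> in \<open>auto simp: e_def restart_error_def d_def \<delta>_def \<tau>0\<close>)
  moreover have "(\<Sum>m<N. d m) \<le> norm (x 0 - \<theta> (L 0)) + (\<Sum>t=1..T. \<delta> t)"
  proof -
    have inj: "inj_on \<tau> {1..<N}"
      by (intro linorder_inj_onI) (use \<tau>less in \<open>fastforce+\<close>)
    have "{..<N} = insert 0 {1..<N}" using N by auto
    then have "(\<Sum>m<N. d m) = norm (x 0 - \<theta> (L 0)) + (\<Sum>m=1..<N. \<delta> (\<tau> m))"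
      by (simp add: d_def)
    also have "(\<Sum>m=1..<N. \<delta> (\<tau> m)) = sum \<delta> (\<tau> ` {1..<N})" using inj by (simp add: sum.reindex)
    also have "\<dots> \<le> (\<Sum>t=1..T. \<delta> t)"
    proof (rule sum_mono2)
      show "\<tau> ` {1..<N} \<subseteq> {1..T}" using \<tau>less[of 0] \<tau>T \<tau>0 by (fastforce simp: Suc_le_eq)
    qed (auto simp: \<delta>_def)
    finally show ?thesis by simp
  qed
  moreover have "Q \<ge> 0"
  proof -
    have "(0::real) \<le> (\<Sum>i<num_switches L 0 T. \<Prod>j=1..i.
        k * \<sigma> (switch_time L T j - switch_time L T (j - 1)))"
      using k \<sigma> by (intro sum_nonneg prod_nonneg) auto
    then show ?thesis using Q[OF adm] by linarith
  qed
  ultimately have e_sum: "(\<Sum>i<N. e i) \<le> Q * (norm (x 0 - \<theta> (L 0)) + (\<Sum>t=1..T. \<delta> t))"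
    by (meson mult_left_mono order_trans)

  have block: "(\<Sum>t\<in>{\<tau> i<..\<tau> (Suc i)}. norm (x t - \<theta> (L (t - 1)))) \<le> k * S * e i"
    if i: "i < N" for i
  proof -
    have ke: "0 \<le> k * e i" using k by (simp add: e_def restart_error_def)
    have "(\<Sum>t\<in>{\<tau> i<..\<tau> (Suc i)}. norm (x t - \<theta> (L (t - 1))))
        \<le> (\<Sum>t\<in>{\<tau> i<..\<tau> (Suc i)}. k * e i * \<sigma> (t - Suc (\<tau> i)))"
    proof (rule sum_mono)
      fix t assume t: "t \<in> {\<tau> i<..\<tau> (Suc i)}"
      then have "L (t - 1) = L (\<tau> i)" using const[OF i, of "t - 1"] by auto
      then show "norm (x t - \<theta> (L (t - 1))) \<le> k * e i * \<sigma> (t - Suc (\<tau> i))"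
        using decay[OF i, of t] t by auto
    qed
    also have "\<dots> = k * e i * (\<Sum>t\<in>{\<tau> i<..\<tau> (Suc i)}. \<sigma> (t - Suc (\<tau> i)))"
      by (simp add: sum_distrib_left)
    also have "(\<Sum>t\<in>{\<tau> i<..\<tau> (Suc i)}. \<sigma> (t - Suc (\<tau> i))) = (\<Sum>t<\<tau> (Suc i) - \<tau> i. \<sigma> t)"
      by (rule sum.reindex_bij_witness[of _ "\<lambda>t. Suc (\<tau> i) + t" "\<lambda>t. t - Suc (\<tau> i)"]) auto
    also have "k * e i * \<dots> \<le> k * e i * S" using S ke by (intro mult_left_mono)
    finally show ?thesis by (simp add: mult_ac)
  qed
  have "{1..T} = {\<tau> 0<..\<tau> N}" using \<tau>0 \<tau>N by auto
  then have "(\<Sum>t=1..T. norm (x t - \<theta> (L (t - 1))))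
      = (\<Sum>i<N. \<Sum>t\<in>{\<tau> i<..\<tau> (Suc i)}. norm (x t - \<theta> (L (t - 1))))"
    using sum_over_blocks[of \<tau> "\<lambda>t. norm (x t - \<theta> (L (t - 1)))" N, OF \<tau>le] by simp
  also have "\<dots> \<le> (\<Sum>i<N. k * S * e i)" using block by (intro sum_mono) auto
  also have "\<dots> = k * S * (\<Sum>i<N. e i)" by (simp add: sum_distrib_left)
  also have "\<dots> \<le> k * S * (Q * (norm (x 0 - \<theta> (L 0)) + (\<Sum>t=1..T. \<delta> t)))"
    using e_sum k S0 by (intro mult_left_mono) auto
  finally show ?thesis by (simp add: \<delta>_def mult_ac)
qed

text \<open>Summing the recursion bounds the sum by \<open>q\<close> times itself plus the sum of the inhomogeneities.\<close>

lemma sum_contractive_recursion: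
  fixes b p :: "nat \<Rightarrow> real"
  assumes "q < 1" and "0 \<le> q" and nonneg: "\<And>t. 0 \<le> b t" and b0: "b 0 \<le> p 0"
    and rec: "\<And>t. Suc t \<le> T \<Longrightarrow> b (Suc t) \<le> q * b t + p (Suc t)"
  shows "(\<Sum>t\<le>T. b t) \<le> (\<Sum>t\<le>T. p t) / (1 - q)"
proof -
  have split: "(\<Sum>t\<le>T. g t) = g 0 + (\<Sum>t<T. g (Suc t))" for g :: "nat \<Rightarrow> real"
    by (metis lessThan_Suc_atMost sum.lessThan_Suc_shift)
  have "(\<Sum>t\<le>T. b t) \<le> p 0 + (\<Sum>t<T. q * b t + p (Suc t))"
    unfolding split using b0 rec by (intro add_mono sum_mono) auto
  also have "\<dots> = (\<Sum>t\<le>T. p t) + q * (\<Sum>t<T. b t)"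
    unfolding split by (simp add: sum.distrib sum_distrib_left)
  also have "\<dots> \<le> (\<Sum>t\<le>T. p t) + q * (\<Sum>t\<le>T. b t)"
    using \<open>0 \<le> q\<close> nonneg by (intro add_left_mono mult_left_mono sum_mono2) auto
  finally have "(\<Sum>t\<le>T. b t) * (1 - q) \<le> (\<Sum>t\<le>T. p t)" by (simp add: algebra_simps)
  then show ?thesis using \<open>q < 1\<close> by (simp add: pos_le_divide_eq)
qed

text \<open>The recursion for the distance to the current steady input arises from the assumed bound, which
  refers to the previous one, by adding the latest move of \<open>\<eta>\<close>; this is the 1 in \<open>kz + 1\<close>.\<close>

lemma sum_input_errors:
  fixes L :: "nat \<Rightarrow> 'c" and \<eta> :: "'c \<Rightarrow> 'u :: real_normed_vector"
    and \<theta> :: "'c \<Rightarrow> 'x :: real_normed_vector" and x :: "nat \<Rightarrow> 'x" and u :: "nat \<Rightarrow> 'u"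
  assumes "0 \<le> ku" "ku < 1" "0 \<le> kz"
    and inputs: "\<And>t. t \<le> T \<Longrightarrow> norm (u t - \<eta> (L (t - 1)))
            \<le> ku * norm ((if t = 0 then \<eta> (L 0) else u (t - 1)) - \<eta> (L (t - 1)))
              + kx * norm (x t - \<theta> (L (t - 1)))
              + kz * norm ((\<theta> (L (t - 1)), \<eta> (L (t - 1))) - (\<theta> (L (t - 2)), \<eta> (L (t - 2))))"
  shows "(\<Sum>t\<le>T. norm (u t - \<eta> (L t))) \<le>
    (kx * (norm (x 0 - \<theta> (L 0)) + (\<Sum>t=1..T. norm (x t - \<theta> (L (t - 1)))))
      + kz * (\<Sum>t=1..T. norm (\<theta> (L t) - \<theta> (L (t - 1))))
      + (kz + 1) * (\<Sum>t=1..T. norm (\<eta> (L t) - \<eta> (L (t - 1))))) / (1 - ku)"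
proof -
  define E where "E t = norm (\<eta> (L t) - \<eta> (L (t - 1)))" for t
  define D where "D t = norm (\<theta> (L t) - \<theta> (L (t - 1)))" for t
  define y where "y t = norm (x t - \<theta> (L (t - 1)))" for t
  define p where "p t = kx * y t + kz * (D (t - 1) + E (t - 1)) + E t" for t
  have zero: "E 0 = 0" "D 0 = 0" by (auto simp: E_def D_def)
  have from1: "(\<Sum>t\<le>T. g t) = g 0 + (\<Sum>t=1..T. g t)" for g :: "nat \<Rightarrow> real"
    by (simp add: atMost_atLeast0 sum.atLeast_Suc_atMost)
  have delayed: "(\<Sum>t\<le>T. g (t - 1)) \<le> (\<Sum>t\<le>T. g t)"
    if "g 0 = 0" "\<And>t. 0 \<le> g t" for g :: "nat \<Rightarrow> real"
  proof -
    have "(\<Sum>t\<le>T. g (t - 1)) = (\<Sum>t<T. g t)"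
      using that(1) sum.lessThan_Suc_shift[of "\<lambda>t. g (t - 1)" T] by (simp add: lessThan_Suc_atMost)
    also have "\<dots> \<le> (\<Sum>t\<le>T. g t)" using that(2) by (intro sum_mono2) auto
    finally show ?thesis .
  qed
  have pair: "norm ((\<theta> (L (t - 1)), \<eta> (L (t - 1))) - (\<theta> (L (t - 2)), \<eta> (L (t - 2))))
      \<le> D (t - 1) + E (t - 1)" for t
    using norm_Pair_le[of "\<theta> (L (t - 1)) - \<theta> (L (t - 2))" "\<eta> (L (t - 1)) - \<eta> (L (t - 2))"]
    by (simp add: D_def E_def numeral_2_eq_2)
  have errors: "(\<Sum>t\<le>T. norm (u t - \<eta> (L t))) \<le> (\<Sum>t\<le>T. p t) / (1 - ku)"
  proof (rule sum_contractive_recursion)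
    show "norm (u 0 - \<eta> (L 0)) \<le> p 0"
      using inputs[of 0] by (simp add: p_def y_def zero)
  next
    fix t assume t: "Suc t \<le> T"
    have "norm (u (Suc t) - \<eta> (L (Suc t))) \<le> norm (u (Suc t) - \<eta> (L t)) + E (Suc t)"
      by (simp add: E_def) (metis norm_minus_commute norm_diff_triangle_le order_refl)
    moreover have "kz * norm ((\<theta> (L (Suc t - 1)), \<eta> (L (Suc t - 1)))
        - (\<theta> (L (Suc t - 2)), \<eta> (L (Suc t - 2)))) \<le> kz * (D t + E t)"
      using mult_left_mono[OF pair[of "Suc t"] \<open>0 \<le> kz\<close>] by simp
    ultimately show "norm (u (Suc t) - \<eta> (L (Suc t))) \<le> ku * norm (u t - \<eta> (L t)) + p (Suc t)"
      using inputs[OF t] by (simp add: p_def y_def)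
  qed (use assms in auto)
  have "(\<Sum>t\<le>T. p t) = kx * (\<Sum>t\<le>T. y t)
      + kz * ((\<Sum>t\<le>T. D (t - 1)) + (\<Sum>t\<le>T. E (t - 1))) + (\<Sum>t\<le>T. E t)"
    by (simp add: p_def sum.distrib flip: sum_distrib_left)
  also have "\<dots> \<le> kx * (\<Sum>t\<le>T. y t) + kz * ((\<Sum>t\<le>T. D t) + (\<Sum>t\<le>T. E t)) + (\<Sum>t\<le>T. E t)"
    using \<open>0 \<le> kz\<close> zero
    by (intro add_mono mult_left_mono delayed order_refl) (auto simp: D_def E_def)
  also have "\<dots> = kx * (norm (x 0 - \<theta> (L 0)) + (\<Sum>t=1..T. y t))
      + kz * (\<Sum>t=1..T. D t) + (kz + 1) * (\<Sum>t=1..T. E t)"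
    unfolding from1 zero by (simp add: y_def algebra_simps)
  finally show ?thesis
    using errors \<open>ku < 1\<close> unfolding D_def E_def y_def
    by (elim order_trans) (simp add: divide_right_mono)
qed

section \<open>Bounded dynamic regret\<close>

lemma regret_le_tracking_errors:
  assumes lip: "\<And>t. t \<le> T \<Longrightarrow> lipschitz_on l UNIV (L t)"
  shows "regret \<eta> \<theta> L x u T \<le> l * ((\<Sum>t\<le>T. norm (u t - \<eta> (L t)))
    + norm (x 0 - \<theta> (L 0)) + (\<Sum>t=1..T. norm (x t - \<theta> (L (t - 1))))
    + (\<Sum>t=1..T. norm (\<theta> (L t) - \<theta> (L (t - 1)))))"
proof -
  have "l \<ge> 0" using lip[of 0] by (simp add: lipschitz_on_def)
  have "regret \<eta> \<theta> L x u T
      \<le> (\<Sum>t\<le>T. l * (norm (u t - \<eta> (L t)) + norm (x t - \<theta> (L t))))"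
    unfolding regret_def atMost_atLeast0
  proof (rule sum_mono)
    fix t assume "t \<in> {0..T}"
    then have "L t (u t, x t) - L t (\<eta> (L t), \<theta> (L t))
        \<le> l * norm (u t - \<eta> (L t), x t - \<theta> (L t))"
      using lipschitz_onD[OF lip, of t "(u t, x t)" "(\<eta> (L t), \<theta> (L t))"]
      by (simp add: dist_norm)
    also have "\<dots> \<le> l * (norm (u t - \<eta> (L t)) + norm (x t - \<theta> (L t)))"
      using \<open>l \<ge> 0\<close> by (intro mult_left_mono norm_Pair_le)
    finally show "L t (u t, x t) - L t (\<eta> (L t), \<theta> (L t)) \<le> \<dots>" .
  qed
  also have "\<dots> = l * ((\<Sum>t\<le>T. norm (u t - \<eta> (L t))) + (\<Sum>t\<le>T. norm (x t - \<theta> (L t))))"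
    by (simp add: sum.distrib flip: sum_distrib_left)
  also have "\<dots> \<le> l * ((\<Sum>t\<le>T. norm (u t - \<eta> (L t))) + (norm (x 0 - \<theta> (L 0))
      + (\<Sum>t=1..T. norm (x t - \<theta> (L (t - 1))) + norm (\<theta> (L t) - \<theta> (L (t - 1))))))"
  proof (intro mult_left_mono add_left_mono)
    have "(\<Sum>t\<le>T. norm (x t - \<theta> (L t)))
        = norm (x 0 - \<theta> (L 0)) + (\<Sum>t=1..T. norm (x t - \<theta> (L t)))"
      by (simp add: atMost_atLeast0 sum.atLeast_Suc_atMost)
    also have "\<dots> \<le> norm (x 0 - \<theta> (L 0))
        + (\<Sum>t=1..T. norm (x t - \<theta> (L (t - 1))) + norm (\<theta> (L t) - \<theta> (L (t - 1))))"
      by (intro add_left_mono sum_mono)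
        (metis norm_minus_commute norm_diff_triangle_le order_refl)
    finally show "(\<Sum>t\<le>T. norm (x t - \<theta> (L t))) \<le> \<dots>" .
  qed fact
  finally show ?thesis by (simp add: sum.distrib add_ac)
qed

theorem theorem2:
  fixes f :: "real ^ 'n \<Rightarrow> real ^ 'm \<Rightarrow> real ^ 'n"
    and A :: "('m, 'n, 'i) algorithm" and i0 :: 'i
    and V :: "('m, 'n) cost set"
    and \<eta> :: "('m, 'n) cost \<Rightarrow> real ^ 'm" and \<theta> :: "('m, 'n) cost \<Rightarrow> real ^ 'n"
    and N0 :: nat and \<phi> \<phi>l k M :: real and \<sigma> :: "nat \<Rightarrow> real"
  assumes "positive_definite_costs f V \<eta> \<theta>"
    and "state_convergence f A i0 V \<theta> k \<sigma>"
    and "state_convergence_after_switch f A i0 V \<theta> N0 \<phi> k \<sigma>"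
    and "bounded_inputs f A i0 V \<eta> \<theta> N0 \<phi>"
    and "lipschitz_costs V"
    and "dwell_time_threshold V N0 k \<sigma> \<phi>l" and "\<phi> \<ge> \<phi>l"
    and "\<exists>S. (\<lambda>T. \<Sum>t=0..T. \<sigma> t) \<longlonglongrightarrow> S \<and> S \<le> M"
  shows "bounded_dynamic_regret f A i0 V \<eta> \<theta> N0 \<phi>"
proof -
  have "\<phi> > 0" using assms(6,7) by (simp add: dwell_time_threshold_def)
  have k: "k \<ge> 1" and \<sigma>: "\<And>t. 0 \<le> \<sigma> t"
    using assms(2) by (auto simp: state_convergence_def class_L_def)
  obtain S where "(\<lambda>T. \<Sum>t=0..T. \<sigma> t) \<longlonglongrightarrow> S" using assms(8) by blast
  then have "\<sigma> sums S" by (simp add: sums_def_le atMost_atLeast0)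
  then have S: "(\<Sum>t<n. \<sigma> t) \<le> S" for n
    using \<sigma> sum_le_suminf[of \<sigma> "{..<n}"] by (simp add: sums_iff)
  then have "S \<ge> 0" using S[of 0] by simp
  obtain Q where "Q \<ge> 0" and Q: "\<And>T L. admissible_costs V N0 \<phi> T L \<Longrightarrow>
      (\<Sum>i<num_switches L 0 T. \<Prod>j=1..i. k * \<sigma> (switch_time L T j - switch_time L T (j - 1))) \<le> Q"
    using contraction_products_bounded[OF assms(2,6,7)] by blast
  obtain l where "l > 0" and lip: "\<And>L. L \<in> V \<Longrightarrow> lipschitz_on l UNIV L"
    using assms(5) unfolding lipschitz_costs_def by blast
  obtain ku kx kz where ku: "0 \<le> ku" "ku < 1" and kx: "0 \<le> kx" and kz: "0 \<le> kz"
    and inputs: "\<And>L x u t. (\<forall>T. admissible_costs V N0 \<phi> T L) \<Longrightarrow> closed_loop f A i0 L x u \<Longrightarrow>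
        norm (u t - \<eta> (L (t - 1)))
            \<le> ku * norm ((if t = 0 then \<eta> (L 0) else u (t - 1)) - \<eta> (L (t - 1)))
              + kx * norm (x t - \<theta> (L (t - 1)))
              + kz * norm ((\<theta> (L (t - 1)), \<eta> (L (t - 1))) - (\<theta> (L (t - 2)), \<eta> (L (t - 2))))"
    using assms(4) unfolding bounded_inputs_def by blast
  define G where "G = k * S * Q"
  have "G \<ge> 0" using k \<open>S \<ge> 0\<close> \<open>Q \<ge> 0\<close> by (simp add: G_def)
  define C\<eta> where "C\<eta> = l * ((kz + 1) / (1 - ku))"
  define C\<theta> where "C\<theta> = l * ((kx * G + kz) / (1 - ku) + G + 1)"
  define C0 where "C0 = l * (kx * (1 + G) / (1 - ku) + 1 + G)"
  have nonneg: "C\<eta> \<ge> 0" "C\<theta> \<ge> 0" "C0 \<ge> 0"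
    using \<open>l > 0\<close> ku kx kz \<open>G \<ge> 0\<close> by (auto simp: C\<eta>_def C\<theta>_def C0_def)
  have main: "regret \<eta> \<theta> L x u T
        \<le> C\<eta> * (\<Sum>t=1..T. norm (\<eta> (L t) - \<eta> (L (t - 1))))
          + C\<theta> * (\<Sum>t=1..T. norm (\<theta> (L t) - \<theta> (L (t - 1)))) + C0 * norm (x 0 - \<theta> (L 0))"
    if adm: "admissible_costs V N0 \<phi> T L" and cl: "closed_loop f A i0 L x u" for T L x u
  proof -
    define e0 where "e0 = norm (x 0 - \<theta> (L 0))"
    define X where "X = (\<Sum>t=1..T. norm (x t - \<theta> (L (t - 1))))"
    define D where "D = (\<Sum>t=1..T. norm (\<theta> (L t) - \<theta> (L (t - 1))))"
    define E where "E = (\<Sum>t=1..T. norm (\<eta> (L t) - \<eta> (L (t - 1))))"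
    define B where "B = (\<Sum>t\<le>T. norm (u t - \<eta> (L t)))"
    have X: "X \<le> G * (e0 + D)"
      unfolding X_def G_def e0_def D_def
      using sum_state_errors[OF assms(2,3) \<open>\<phi> > 0\<close> adm cl S Q] .
    have "B \<le> (kx * (e0 + X) + kz * D + (kz + 1) * E) / (1 - ku)"
      unfolding B_def e0_def X_def D_def E_def
    proof (rule sum_input_errors[OF ku kz])
      fix t assume "t \<le> T"
      \<comment> \<open>The bound on the inputs speaks of sequences admissible on all horizons: freeze the cost at \<open>T\<close>.\<close>
      let ?L = "\<lambda>t. L (min t T)"
      have "?L t = L t" if "t < T" for t using that by simp
      then obtain x' u' where cl': "closed_loop f A i0 ?L x' u'"
        and u': "\<forall>t\<le>T. u' t = u t" and x': "\<forall>t\<le>Suc T. x' t = x t"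
        by (rule closed_loop_change_future[OF cl])
      have "\<forall>T'. admissible_costs V N0 \<phi> T' ?L"
        using admissible_costs_freeze[OF adm \<open>\<phi> > 0\<close> order_refl] by blast
      note bound = inputs[OF this cl', of t]
      have "min (t - 1) T = t - 1" "min (t - 2) T = t - 2" "min 0 T = 0"
        "u' t = u t" "u' (t - 1) = u (t - 1)" "x' t = x t"
        using \<open>t \<le> T\<close> u' x' by auto
      with bound show "norm (u t - \<eta> (L (t - 1)))
            \<le> ku * norm ((if t = 0 then \<eta> (L 0) else u (t - 1)) - \<eta> (L (t - 1)))
              + kx * norm (x t - \<theta> (L (t - 1)))
              + kz * norm ((\<theta> (L (t - 1)), \<eta> (L (t - 1))) - (\<theta> (L (t - 2)), \<eta> (L (t - 2))))"
        by (simp only:)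
    qed
    also have "\<dots> \<le> (kx * (e0 + G * (e0 + D)) + kz * D + (kz + 1) * E) / (1 - ku)"
      using X kx ku by (intro divide_right_mono add_right_mono mult_left_mono add_left_mono) auto
    also have "\<dots> = kx * (1 + G) / (1 - ku) * e0 + (kx * G + kz) / (1 - ku) * D
        + (kz + 1) / (1 - ku) * E"
      by (simp add: add_divide_distrib algebra_simps)
    finally have B: "B \<le> \<dots>" .
    have "regret \<eta> \<theta> L x u T \<le> l * (B + e0 + X + D)"
      unfolding B_def e0_def X_def D_def
      using adm lip by (intro regret_le_tracking_errors) (simp add: admissible_costs_def)
    also have "\<dots> \<le> l * ((kx * (1 + G) / (1 - ku) * e0 + (kx * G + kz) / (1 - ku) * D
        + (kz + 1) / (1 - ku) * E) + e0 + G * (e0 + D) + D)"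
      using X B \<open>l > 0\<close> by (intro mult_left_mono add_mono) auto
    also have "\<dots> = C\<eta> * E + C\<theta> * D + C0 * e0"
      by (simp add: C\<eta>_def C\<theta>_def C0_def algebra_simps)
    finally show ?thesis by (simp add: E_def D_def e0_def)
  qed
  show ?thesis
    unfolding bounded_dynamic_regret_def
  proof (rule allI, rule exI[of _ C\<eta>], rule conjI[OF nonneg(1)], rule exI[of _ C\<theta>],
      rule conjI[OF nonneg(2)], rule allI)
    fix x0 r
    \<comment> \<open>For negative \<open>r\<close> no sequence qualifies; the absolute value only keeps the offset nonnegative.\<close>
    show "\<exists>C\<ge>0. \<forall>T L x u. admissible_costs V N0 \<phi> T L \<and> closed_loop f A i0 L x u \<and> x 0 = x0 \<and>
        norm (x0 - \<theta> (L 0)) \<le> r \<longrightarrow> regret \<eta> \<theta> L x u T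
          \<le> C\<eta> * (\<Sum>t=1..T. norm (\<eta> (L t) - \<eta> (L (t - 1))))
            + C\<theta> * (\<Sum>t=1..T. norm (\<theta> (L t) - \<theta> (L (t - 1)))) + C"
    proof (intro exI[of _ "C0 * \<bar>r\<bar>"] conjI allI impI)
      show "0 \<le> C0 * \<bar>r\<bar>" using nonneg by simp
    next
      fix T L x u
      assume a: "admissible_costs V N0 \<phi> T L \<and> closed_loop f A i0 L x u \<and> x 0 = x0 \<and>
        norm (x0 - \<theta> (L 0)) \<le> r"
      have "C0 * norm (x 0 - \<theta> (L 0)) \<le> C0 * \<bar>r\<bar>"
        using a nonneg(3) by (intro mult_left_mono) auto
      then show "regret \<eta> \<theta> L x u T
          \<le> C\<eta> * (\<Sum>t=1..T. norm (\<eta> (L t) - \<eta> (L (t - 1))))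
            + C\<theta> * (\<Sum>t=1..T. norm (\<theta> (L t) - \<theta> (L (t - 1)))) + C0 * \<bar>r\<bar>"
        using main[of T L x u] a by linarith
    qed
  qed
qed

end
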